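(* Let $m,n\geq 1$ be integers and let $\Phi : M_n \to M_n$ be a Hermiticity-preserving linear map with adjoint $\Phi^*$. Then the maximum number of strictly negative eigenvalues (counted with multiplicity) that $(I_m \otimes \Phi^* )(\rho)$ can have, as $\rho$ ranges over all density matrices in $M_m \otimes M_n$, is exactly $\nu_m(\Phi)$.
   Context: $M_n$ is the set of $n\times n$ complex matrices. A density matrix is a positive semidefinite matrix with trace $1$. $A \succeq O$ means that $A$ is (Hermitian) positive semidefinite. A linear map $\Phi : M_n\to M_n$ is Hermiticity-preserving if $\Phi(X)$ is Hermitian whenever $X$ is Hermitian. Its adjoint $\Phi^*$ is the Hermiticity-preserving linear map on $M_n$ defined by $\mathrm{Tr}(X\Phi(Y)) = \mathrm{Tr}(\Phi^*(X)Y)$ for all Hermitian $X,Y\in M_n$. $I_m\otimes\Phi$ denotes the linear map on $M_m\otimes M_n$ that acts as the identity map on $M_m$ tensored with $\Phi$. The support $\mathrm{supp}(\rho)$ of a Hermitian matrix is its range. The non-$m$-positive dimension $\nu_m(\Phi)$ is the maximum of $\dim(\mathcal{S})$ over all subspaces $\mathcal{S}\subseteq \mathbb{C}^m\otimes\mathbb{C}^n$ such that $(I_m\otimes\Phi)(\rho)\not\succeq O$ for every density matrix $\rho\in M_m\otimes M_n$ with $\mathrm{supp}(\rho)\subseteq\mathcal{S}$ (the zero subspace satisfies this vacuously). *)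

theory Defs
  imports "HOL-Analysis.Analysis" "HOL-Computational_Algebra.Polynomial"
begin

text \<open>
  The space \<open>M_n\<close> is \<open>complex^'n^'n\<close> with \<open>n = CARD('n) \<ge> 1\<close>. The tensor products
  \<open>C^m \<otimes> C^n\<close> and \<open>M_m \<otimes> M_n\<close> are identified with \<open>complex^('m \<times> 'n)\<close> and
  \<open>complex^('m \<times> 'n)^('m \<times> 'n)\<close> through the product basis.
\<close>

subsection \<open>Hermitian and density matrices\<close>

definition ctranspose :: "complex^'n^'m \<Rightarrow> complex^'m^'n" where
  "ctranspose A = (\<chi> i j. cnj (A $ j $ i))"

definition hermitian :: "complex^'n^'n \<Rightarrow> bool" where
  "hermitian A \<longleftrightarrow> ctranspose A = A"

text \<open>The quadratic form of a Hermitian matrix is real, so taking its real part loses nothing.\<close>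

definition psd :: "complex^'n^'n \<Rightarrow> bool" where
  "psd A \<longleftrightarrow> hermitian A \<and> (\<forall>x. 0 \<le> Re (\<Sum>i\<in>UNIV. cnj (x $ i) * (A *v x) $ i))"

definition density_matrix :: "complex^'n^'n \<Rightarrow> bool" where
  "density_matrix \<rho> \<longleftrightarrow> psd \<rho> \<and> trace \<rho> = 1"

definition supp :: "complex^'n^'n \<Rightarrow> (complex^'n) set" where
  "supp \<rho> = range ((*v) \<rho>)"

subsection \<open>Eigenvalues with multiplicity\<close>

definition charpoly :: "complex^'n^'n \<Rightarrow> complex poly" where
  "charpoly A = det (\<chi> i j. (if i = j then [:0, 1:] else 0) - [:A $ i $ j:])"

text \<open>
  The multiset \<open>proots (charpoly A)\<close> lists the eigenvalues of \<open>A\<close> with their algebraic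
  multiplicities (which for Hermitian \<open>A\<close> are also the geometric ones).
\<close>

definition num_neg_eigenvalues :: "complex^'n^'n \<Rightarrow> nat" where
  "num_neg_eigenvalues A = size (filter_mset (\<lambda>z. z \<in> \<real> \<and> Re z < 0) (proots (charpoly A)))"

subsection \<open>Linear maps on matrices\<close>

definition mscale :: "complex \<Rightarrow> complex^'n^'m \<Rightarrow> complex^'n^'m" where
  "mscale c A = (\<chi> i j. c * A $ i $ j)"

interpretation mscale: vector_space "mscale :: complex \<Rightarrow> complex^'n^'m \<Rightarrow> complex^'n^'m"
  by unfold_locales (simp_all add: mscale_def vec_eq_iff algebra_simps)

definition hermiticity_preserving :: "(complex^'n^'n \<Rightarrow> complex^'n^'n) \<Rightarrow> bool" where
  "hermiticity_preserving \<Phi> \<longleftrightarrow> (\<forall>X. hermitian X \<longrightarrow> hermitian (\<Phi> X))"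

definition is_adjoint_map ::
    "(complex^'n^'n \<Rightarrow> complex^'n^'n) \<Rightarrow> (complex^'n^'n \<Rightarrow> complex^'n^'n) \<Rightarrow> bool" where
  "is_adjoint_map \<Phi> \<Psi> \<longleftrightarrow>
     Vector_Spaces.linear mscale mscale \<Psi> \<and> hermiticity_preserving \<Psi> \<and>
     (\<forall>X Y. hermitian X \<longrightarrow> hermitian Y \<longrightarrow> trace (X ** \<Phi> Y) = trace (\<Psi> X ** Y))"

text \<open>Existence and uniqueness are proved in \<open>ex1_adjoint_map\<close> below.\<close>

definition adjoint_map ::
    "(complex^'n^'n \<Rightarrow> complex^'n^'n) \<Rightarrow> complex^'n^'n \<Rightarrow> complex^'n^'n" where
  "adjoint_map \<Phi> = (THE \<Psi>. is_adjoint_map \<Phi> \<Psi>)"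

text \<open>
  The map \<open>I_m \<otimes> \<Phi>\<close> applies \<open>\<Phi>\<close> to each of the \<open>m \<times> m\<close> blocks of size \<open>n \<times> n\<close>; for
  linear \<open>\<Phi>\<close> it is the linear map with \<open>A \<otimes> B \<mapsto> A \<otimes> \<Phi> B\<close>, see \<open>id_tensor_kron\<close> and
  \<open>linear_id_tensor\<close>.
\<close>

definition id_tensor ::
    "(complex^'n^'n \<Rightarrow> complex^'n^'n) \<Rightarrow>
     complex^('m::finite \<times> 'n::finite)^('m \<times> 'n) \<Rightarrow> complex^('m \<times> 'n)^('m \<times> 'n)" where
  "id_tensor \<Phi> X = (\<chi> p q. \<Phi> (\<chi> k l. X $ (fst p, k) $ (fst q, l)) $ snd p $ snd q)"

definition kron ::
    "complex^'m^'m \<Rightarrow> complex^'n^'n \<Rightarrow> complex^('m::finite \<times> 'n::finite)^('m \<times> 'n)" where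
  "kron A B = (\<chi> p q. A $ fst p $ fst q * B $ snd p $ snd q)"

lemma id_tensor_kron:
  assumes "Vector_Spaces.linear mscale mscale \<Phi>"
  shows "id_tensor \<Phi> (kron A B) = kron A (\<Phi> B)"
proof -
  interpret Vector_Spaces.linear mscale mscale \<Phi> by fact
  have "(\<chi> k l. A $ i $ j * B $ k $ l) = mscale (A $ i $ j) B" for i j
    by (simp add: mscale_def)
  then show ?thesis
    by (simp add: id_tensor_def kron_def vec_eq_iff scale) (simp add: mscale_def)
qed

lemma linear_id_tensor:
  assumes "Vector_Spaces.linear mscale mscale \<Phi>"
  shows "Vector_Spaces.linear mscale mscale (id_tensor \<Phi>)"
proof -
  interpret Vector_Spaces.linear mscale mscale \<Phi> by fact
  have 1: "(\<chi> k l. (X + Y) $ (a, k) $ (b, l)) =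
      (\<chi> k l. X $ (a, k) $ (b, l)) + (\<chi> k l. Y $ (a, k) $ (b, l))" for X Y a b
    by (simp add: vec_eq_iff)
  have 2: "(\<chi> k l. mscale c X $ (a, k) $ (b, l)) = mscale c (\<chi> k l. X $ (a, k) $ (b, l))"
    for X a b c
    by (simp add: vec_eq_iff mscale_def)
  show ?thesis
    by unfold_locales
      (simp_all only: id_tensor_def 1 2 add scale, simp_all add: vec_eq_iff mscale_def)
qed

subsection \<open>The non-\<open>m\<close>-positive dimension\<close>

definition non_positive_subspace ::
    "(complex^'n^'n \<Rightarrow> complex^'n^'n) \<Rightarrow> (complex^('m::finite \<times> 'n::finite)) set \<Rightarrow> bool" where
  "non_positive_subspace \<Phi> S \<longleftrightarrow>
     vec.subspace S \<and> (\<forall>\<rho>. density_matrix \<rho> \<and> supp \<rho> \<subseteq> S \<longrightarrow> \<not> psd (id_tensor \<Phi> \<rho>))"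

definition non_positive_dim ::
    "'m::finite itself \<Rightarrow> (complex^'n^'n \<Rightarrow> complex^'n^'n) \<Rightarrow> nat" where
  "non_positive_dim (M :: 'm itself) \<Phi> =
     Max {vec.dim S |S :: (complex^('m \<times> 'n)) set. non_positive_subspace \<Phi> S}"

text \<open>The set under \<^const>\<open>Max\<close> is finite and nonempty.\<close>

lemma finite_non_positive_dims:
  fixes \<Phi> :: "complex^'n^'n \<Rightarrow> complex^'n^'n"
  shows "finite {vec.dim S |S :: (complex^('m::finite \<times> 'n)) set. non_positive_subspace \<Phi> S}"
  by (rule finite_subset[of _ "{..CARD('m \<times> 'n)}"])
    (use dim_subset_UNIV_cart_gen in \<open>auto simp del: card_prod\<close>)

lemma non_positive_subspace_zero: "non_positive_subspace \<Phi> {0}"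
proof -
  have "\<not> supp \<rho> \<subseteq> {0}" if "density_matrix \<rho>" for \<rho> :: "complex^('b \<times> 'a)^('b \<times> 'a)"
  proof
    assume "supp \<rho> \<subseteq> {0}"
    then have "\<rho> *v x = 0 *v x" for x
      by (auto simp: supp_def)
    then have "\<rho> = 0"
      by (metis matrix_eq)
    with that show False
      by (simp add: density_matrix_def trace_def)
  qed
  then show ?thesis
    by (auto simp: non_positive_subspace_def)
qed

subsection \<open>Existence and uniqueness of the adjoint map\<close>

lemma hermitian_nth: "hermitian A \<Longrightarrow> cnj (A $ i $ j) = A $ j $ i"
  by (metis (no_types, lifting) ctranspose_def hermitian_def vec_lambda_beta)

lemma hermitian_cases:
  fixes X :: "complex^'n^'n"
  obtains H K where "hermitian H" "hermitian K" "X = H + mscale \<i> K"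
proof
  show "hermitian (mscale (1/2) (X + ctranspose X))"
    by (simp add: hermitian_def mscale_def ctranspose_def vec_eq_iff algebra_simps)
  show "hermitian (mscale (-\<i>/2) (X - ctranspose X))"
    by (simp add: hermitian_def mscale_def ctranspose_def vec_eq_iff algebra_simps)
  show "X = mscale (1/2) (X + ctranspose X) + mscale \<i> (mscale (-\<i>/2) (X - ctranspose X))"
    by (simp add: mscale_def ctranspose_def vec_eq_iff field_simps)
qed

lemma hermitian_diff: "hermitian A \<Longrightarrow> hermitian B \<Longrightarrow> hermitian (A - B)"
  by (simp add: hermitian_def ctranspose_def vec_eq_iff)

lemma hermitian_trace_square_zero:
  assumes "hermitian A" "trace (A ** A) = 0"
  shows "A = 0"
proof -
  have "trace (A ** A) = (\<Sum>i\<in>UNIV. \<Sum>j\<in>UNIV. A $ i $ j * cnj (A $ i $ j))"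
    by (simp add: trace_def matrix_matrix_mult_def hermitian_nth[OF assms(1)])
  also have "\<dots> = of_real (\<Sum>i\<in>UNIV. \<Sum>j\<in>UNIV. (cmod (A $ i $ j))\<^sup>2)"
    by (simp only: complex_norm_square of_real_sum)
  finally have "(\<Sum>i\<in>UNIV. \<Sum>j\<in>UNIV. (cmod (A $ i $ j))\<^sup>2) = 0"
    using assms(2) by (metis of_real_eq_0_iff)
  then show ?thesis
    by (simp add: sum_nonneg_eq_0_iff sum_nonneg vec_eq_iff)
qed

lemma linear_ctranspose:
  assumes "Vector_Spaces.linear mscale mscale \<Phi>" "hermiticity_preserving \<Phi>"
  shows "\<Phi> (ctranspose X) = ctranspose (\<Phi> X)"
proof -
  interpret Vector_Spaces.linear mscale mscale \<Phi> by fact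
  obtain H K where HK: "hermitian H" "hermitian K" "X = H + mscale \<i> K"
    by (rule hermitian_cases)
  have *: "ctranspose (A + mscale \<i> B) = A + mscale (-\<i>) B" if "hermitian A" "hermitian B" for A B
    using that by (simp add: vec_eq_iff mscale_def ctranspose_def hermitian_nth)
  have "hermitian (\<Phi> H)" "hermitian (\<Phi> K)"
    using assms(2) HK by (auto simp: hermiticity_preserving_def)
  then show ?thesis
    using HK by (simp only: * add scale)
qed

lemma ex1_adjoint_map:
  fixes \<Phi> :: "complex^'n^'n \<Rightarrow> complex^'n^'n"
  assumes lin: "Vector_Spaces.linear mscale mscale \<Phi>" and hp: "hermiticity_preserving \<Phi>"
  shows "\<exists>!\<Psi>. is_adjoint_map \<Phi> \<Psi>"
proof (rule ex_ex1I)
  interpret Vector_Spaces.linear mscale mscale \<Phi> by fact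
  define E :: "'n \<Rightarrow> 'n \<Rightarrow> complex^'n^'n"
    where "E = (\<lambda>i j. \<chi> k l. if k = i \<and> l = j then 1 else 0)"
  define \<Psi> :: "complex^'n^'n \<Rightarrow> complex^'n^'n"
    where "\<Psi> = (\<lambda>X. \<chi> i j. trace (X ** \<Phi> (E j i)))"
  have ctE: "ctranspose (E i j) = E j i" for i j
    by (auto simp: E_def ctranspose_def vec_eq_iff)
  have Y: "Y = (\<Sum>i\<in>UNIV. \<Sum>j\<in>UNIV. mscale (Y $ i $ j) (E i j))" for Y
  proof -
    have "(\<Sum>i\<in>UNIV. \<Sum>j\<in>UNIV. mscale (Y $ i $ j) (E i j)) $ k $ l =
        (\<Sum>i\<in>UNIV. \<Sum>j\<in>UNIV. if l = j then (if k = i then Y $ i $ j else 0) else 0)" for k l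
      unfolding sum_component mscale_def E_def by (intro sum.cong refl) auto
    also have "(\<Sum>i\<in>UNIV. \<Sum>j\<in>UNIV. if l = j then (if k = i then Y $ i $ j else 0) else 0) = Y $ k $ l"
      for k l by simp
    finally show ?thesis
      by (simp only: vec_eq_iff) simp
  qed
  have tr_sum: "trace (X ** sum f S) = (\<Sum>s\<in>S. trace (X ** f s))" if "finite S"
    for X :: "complex^'n^'n" and f :: "'n \<Rightarrow> complex^'n^'n" and S
    using that by (induction S rule: finite_induct)
      (simp_all add: matrix_add_ldistrib trace_add trace_0[unfolded mat_0])
  have distrib: "(A + B) ** C = A ** C + B ** C" for A B C :: "complex^'n^'n"
    by (simp add: matrix_matrix_mult_def vec_eq_iff sum.distrib algebra_simps)
  have tr_scale: "trace (X ** mscale c Y) = c * trace (X ** Y)"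
    "trace (mscale c X ** Y) = c * trace (X ** Y)" for c and X Y :: "complex^'n^'n"
    by (simp_all add: trace_def matrix_matrix_mult_def mscale_def sum_distrib_left algebra_simps)
  have tr_ct: "cnj (trace (X ** Y)) = trace (ctranspose Y ** ctranspose X)"
    for X Y :: "complex^'n^'n"
    by (simp add: trace_def matrix_matrix_mult_def ctranspose_def mult.commute)
  have "trace (X ** \<Phi> Y) = trace (\<Psi> X ** Y)" for X Y
  proof -
    have "\<Phi> Y = (\<Sum>i\<in>UNIV. \<Sum>j\<in>UNIV. mscale (Y $ i $ j) (\<Phi> (E i j)))"
      by (subst Y[of Y]) (simp add: sum scale)
    then have "trace (X ** \<Phi> Y) =
        (\<Sum>i\<in>UNIV. \<Sum>j\<in>UNIV. Y $ i $ j * trace (X ** \<Phi> (E i j)))"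
      by (simp add: tr_sum tr_scale)
    also have "\<dots> = (\<Sum>i\<in>UNIV. \<Sum>j\<in>UNIV. Y $ j $ i * trace (X ** \<Phi> (E j i)))"
      by (rule sum.swap)
    also have "\<dots> = trace (\<Psi> X ** Y)"
    proof -
      have "trace (P ** Y) = (\<Sum>i\<in>UNIV. \<Sum>j\<in>UNIV. Y $ j $ i * P $ i $ j)" for P
        by (simp add: trace_def matrix_matrix_mult_def mult.commute)
      then show ?thesis
        by (simp add: \<Psi>_def)
    qed
    finally show ?thesis .
  qed
  moreover have "Vector_Spaces.linear mscale mscale \<Psi>"
  proof unfold_locales
    show "\<Psi> (X + X') = \<Psi> X + \<Psi> X'" for X X'
      by (simp add: \<Psi>_def vec_eq_iff distrib trace_add)
    show "\<Psi> (mscale c X) = mscale c (\<Psi> X)" for c X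
      by (simp add: \<Psi>_def vec_eq_iff tr_scale) (simp add: mscale_def)
  qed
  moreover have "hermitian (\<Psi> X)" if "hermitian X" for X
  proof -
    have "cnj (\<Psi> X $ j $ i) = \<Psi> X $ i $ j" for i j
    proof -
      have "cnj (\<Psi> X $ j $ i) = trace (\<Phi> (E j i) ** X)"
        using that by (simp add: \<Psi>_def tr_ct hermitian_def ctE flip: linear_ctranspose[OF lin hp])
      then show ?thesis
        by (metis (no_types, lifting) \<Psi>_def trace_mul_sym vec_lambda_beta)
    qed
    then show ?thesis
      by (simp add: hermitian_def ctranspose_def vec_eq_iff)
  qed
  ultimately show "\<exists>\<Psi>. is_adjoint_map \<Phi> \<Psi>"
    by (auto simp: is_adjoint_map_def hermiticity_preserving_def)
next
  fix \<Psi> \<Psi>'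
  assume 1: "is_adjoint_map \<Phi> \<Psi>" and 2: "is_adjoint_map \<Phi> \<Psi>'"
  interpret P: Vector_Spaces.linear mscale mscale \<Psi> using 1 by (simp add: is_adjoint_map_def)
  interpret P': Vector_Spaces.linear mscale mscale \<Psi>' using 2 by (simp add: is_adjoint_map_def)
  have eq: "\<Psi> X = \<Psi>' X" if X: "hermitian X" for X
  proof -
    let ?D = "\<Psi> X - \<Psi>' X"
    have D: "hermitian ?D"
      using 1 2 X by (auto simp: is_adjoint_map_def hermiticity_preserving_def hermitian_diff)
    have "trace (?D ** ?D) = trace (\<Psi> X ** ?D) - trace (\<Psi>' X ** ?D)"
      by (simp only: trace_def matrix_matrix_mult_def vector_minus_component vec_lambda_beta
        left_diff_distrib sum_subtractf)
    also have "\<dots> = 0"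
      using 1 2 X D unfolding is_adjoint_map_def by (metis right_minus_eq)
    finally have "?D = 0"
      by (rule hermitian_trace_square_zero[OF D])
    then show ?thesis by simp
  qed
  show "\<Psi> = \<Psi>'"
  proof
    fix X :: "complex^'n^'n"
    obtain H K where "hermitian H" "hermitian K" "X = H + mscale \<i> K"
      by (rule hermitian_cases)
    then show "\<Psi> X = \<Psi>' X"
      by (simp add: P.add P.scale P'.add P'.scale eq)
  qed
qed

corollary is_adjoint_map_adjoint_map:
  assumes "Vector_Spaces.linear mscale mscale \<Phi>" "hermiticity_preserving \<Phi>"
  shows "is_adjoint_map \<Phi> (adjoint_map \<Phi>)"
  unfolding adjoint_map_def by (rule theI'[OF ex1_adjoint_map[OF assms]])

end

theory Submission
  imports Defs
begin

text \<open>
  The number of negative eigenvalues of a Hermitian \<open>H\<close> is the largest dimension of a subspace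
  on which its quadratic form is negative definite. If \<open>\<rho>\<close> is a density matrix and
  \<open>H = (I \<otimes> \<Phi>\<^sup>*)(\<rho>)\<close> is negative definite on \<open>S\<close>, then
  \<open>Tr (\<rho> (I \<otimes> \<Phi>)(\<sigma>)) = Tr (H \<sigma>) < 0\<close> for every density matrix \<open>\<sigma>\<close> supported in \<open>S\<close>, so
  \<open>(I \<otimes> \<Phi>)(\<sigma>)\<close> is not positive semidefinite. Conversely, if \<open>(I \<otimes> \<Phi>)(\<sigma>)\<close> is never positive
  semidefinite, then the compact convex set of these matrices can be strictly separated from the
  closed cone of positive semidefinite matrices; since that cone is self-dual, the separating
  functional is given, up to normalisation, by a density matrix \<open>\<rho>\<close> for which
  \<open>(I \<otimes> \<Phi>\<^sup>*)(\<rho>)\<close> is negative definite on \<open>S\<close>.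
\<close>

subsection \<open>The standard Hermitian form\<close>

text \<open>Conjugate-linear in the first argument. The real inner product \<open>inner\<close> on
  the same type is its real part.\<close>

definition cdot :: "complex^'n \<Rightarrow> complex^'n \<Rightarrow> complex" where
  "cdot x y = (\<Sum>i\<in>UNIV. cnj (x $ i) * y $ i)"

lemma cdot_add: "cdot x (y + z) = cdot x y + cdot x z" "cdot (y + z) x = cdot y x + cdot z x"
  and cdot_diff: "cdot x (y - z) = cdot x y - cdot x z" "cdot (y - z) x = cdot y x - cdot z x"
  and cdot_scale: "cdot x (c *s y) = c * cdot x y" "cdot (c *s y) x = cnj c * cdot y x"
  and cdot_zero [simp]: "cdot x 0 = 0" "cdot 0 x = 0"
  by (simp_all add: cdot_def algebra_simps sum.distrib sum_subtractf sum_distrib_left)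

lemma cdot_sum: "cdot x (\<Sum>i\<in>I. f i) = (\<Sum>i\<in>I. cdot x (f i))"
  by (induction I rule: infinite_finite_induct) (simp_all add: cdot_add)

lemma cnj_cdot: "cnj (cdot x y) = cdot y x"
  by (simp add: cdot_def mult.commute)

lemma cdot_self: "cdot x x = of_real ((norm x)\<^sup>2)"
proof -
  have "cdot x x = of_real (\<Sum>i\<in>UNIV. (norm (x $ i))\<^sup>2)"
    by (simp only: cdot_def complex_norm_square of_real_sum mult.commute)
  also have "(\<Sum>i\<in>UNIV. (norm (x $ i))\<^sup>2) = (norm x)\<^sup>2"
    by (simp add: norm_vec_def L2_set_def sum_nonneg)
  finally show ?thesis .
qed

lemma cdot_self_eq_0 [simp]: "cdot x x = 0 \<longleftrightarrow> x = 0"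
  by (simp add: cdot_self)

lemma norm_vector_smult: "norm (c *s y) = norm c * norm y" for y :: "complex^'n"
  by (simp add: norm_vec_def L2_set_def norm_mult power_mult_distrib real_sqrt_mult
      flip: sum_distrib_left)

lemma continuous_on_cdot [continuous_intros]:
  assumes "continuous_on S f" "continuous_on S g"
  shows "continuous_on S (\<lambda>x. cdot (f x) (g x))"
  unfolding cdot_def by (intro continuous_intros assms)

lemma continuous_on_matrix_vector_mult [continuous_intros]:
  fixes A :: "'a::topological_space \<Rightarrow> complex^'n^'m"
  assumes "continuous_on S A" "continuous_on S f"
  shows "continuous_on S (\<lambda>x. A x *v f x)"
  unfolding matrix_vector_mult_def by (intro continuous_intros assms)

lemma cdot_ctranspose: "cdot (A *v x) y = cdot x (ctranspose A *v y)"
proof -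
  have "cdot (A *v x) y = (\<Sum>i\<in>UNIV. \<Sum>j\<in>UNIV. cnj (A $ i $ j) * cnj (x $ j) * y $ i)"
    by (simp add: cdot_def matrix_vector_mult_def sum_distrib_right)
  also have "\<dots> = (\<Sum>j\<in>UNIV. \<Sum>i\<in>UNIV. cnj (A $ i $ j) * cnj (x $ j) * y $ i)"
    by (rule sum.swap)
  also have "\<dots> = cdot x (ctranspose A *v y)"
    by (simp add: cdot_def matrix_vector_mult_def ctranspose_def sum_distrib_left algebra_simps)
  finally show ?thesis .
qed

lemma cdot_hermitian: "hermitian H \<Longrightarrow> cdot (H *v x) y = cdot x (H *v y)"
  by (simp add: cdot_ctranspose hermitian_def)

lemma psd_iff: "psd A \<longleftrightarrow> hermitian A \<and> (\<forall>x. 0 \<le> Re (cdot x (A *v x)))"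
  by (simp add: psd_def cdot_def)

subsection \<open>Spectral theorem\<close>

text \<open>An indexed family rather than a set of vectors, so that a vector \<open>u i\<close> can
  be paired with an eigenvalue \<open>d i\<close> and repeated eigenvalues are counted by their
  indices.\<close>

definition orthonormal :: "'i set \<Rightarrow> ('i \<Rightarrow> complex^'n) \<Rightarrow> bool" where
  "orthonormal I u \<longleftrightarrow> (\<forall>i\<in>I. \<forall>j\<in>I. cdot (u i) (u j) = (if i = j then 1 else 0))"

lemma orthonormal_subset: "orthonormal I u \<Longrightarrow> J \<subseteq> I \<Longrightarrow> orthonormal J u"
  unfolding orthonormal_def by blast

lemma orthonormal_inj_on:
  assumes "orthonormal I u"
  shows "inj_on u I"
  by (rule inj_onI) (use assms in \<open>metis orthonormal_def zero_neq_one\<close>)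

lemma orthonormal_independent:
  assumes "orthonormal I u" "finite I"
  shows "vec.independent (u ` I)"
  unfolding vec.independent_explicit
proof (intro conjI allI impI ballI)
  show "finite (u ` I)" using assms by simp
  fix c v assume "(\<Sum>v\<in>u ` I. c v *s v) = 0" and "v \<in> u ` I"
  then obtain i where i: "i \<in> I" "v = u i" by auto
  have "0 = cdot (u i) (\<Sum>v\<in>u ` I. c v *s v)"
    using \<open>_ = 0\<close> by simp
  also have "\<dots> = (\<Sum>j\<in>I. c (u j) * cdot (u i) (u j))"
    using orthonormal_inj_on[OF assms(1)] by (simp add: sum.reindex cdot_sum cdot_scale)
  also have "\<dots> = (\<Sum>j\<in>I. if i = j then c (u j) else 0)"
    using assms(1) i by (intro sum.cong) (auto simp: orthonormal_def)
  finally show "c v = 0"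
    using i assms(2) by simp
qed

lemma orthonormal_dim_span:
  assumes "orthonormal I u" "finite I"
  shows "vec.dim (vec.span (u ` I)) = card I"
  using orthonormal_independent[OF assms] orthonormal_inj_on[OF assms(1)]
  by (simp add: vec.dim_eq_card_independent card_image)

text \<open>Gram-Schmidt: fewer than \<open>CARD('n)\<close> vectors do not span, and subtracting
  from a vector outside the span its projection onto the span leaves a nonzero orthogonal
  remainder.\<close>

lemma exists_orthogonal_nonzero:
  fixes u :: "'i \<Rightarrow> complex^'n"
  assumes "orthonormal I u" "finite I" "card I < CARD('n)"
  obtains w where "w \<noteq> 0" "\<And>i. i \<in> I \<Longrightarrow> cdot (u i) w = 0"
proof -
  have "vec.span (u ` I) \<noteq> UNIV"
    using orthonormal_dim_span[OF assms(1,2)] assms(3) by (metis less_irrefl vec_dim_card)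
  then obtain v where v: "v \<notin> vec.span (u ` I)" by auto
  define w where "w = v - (\<Sum>i\<in>I. cdot (u i) v *s u i)"
  have "(\<Sum>i\<in>I. cdot (u i) v *s u i) \<in> vec.span (u ` I)"
    by (intro vec.span_sum vec.span_scale vec.span_base imageI)
  then have "w \<noteq> 0"
    using v by (auto simp: w_def)
  moreover have "cdot (u i) w = 0" if "i \<in> I" for i
  proof -
    have "(\<Sum>j\<in>I. cdot (u j) v * cdot (u i) (u j)) = (\<Sum>j\<in>I. if i = j then cdot (u j) v else 0)"
      using assms(1) that by (intro sum.cong) (auto simp: orthonormal_def)
    then show ?thesis
      using that assms(2) by (simp add: w_def cdot_diff cdot_sum cdot_scale)
  qed
  ultimately show ?thesis by (rule that)
qed

definition eigenbasis :: "complex^'n^'n \<Rightarrow> ('n \<Rightarrow> complex^'n) \<Rightarrow> ('n \<Rightarrow> real) \<Rightarrow> bool" where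
  "eigenbasis H u d \<longleftrightarrow> orthonormal UNIV u \<and> (\<forall>i. H *v u i = of_real (d i) *s u i)"

lemma exists_eigenvector_orthogonal:
  fixes H :: "complex^'n^'n"
  assumes H: "hermitian H"
    and on: "orthonormal I u" "finite I" "card I < CARD('n)"
    and ev: "\<And>i. i \<in> I \<Longrightarrow> H *v u i = of_real (d i) *s u i"
  obtains x r where "cdot x x = 1" "\<And>i. i \<in> I \<Longrightarrow> cdot (u i) x = 0" "H *v x = of_real r *s x"
proof -
  define W where "W = {x. \<forall>i\<in>I. cdot (u i) x = 0}"
  define q where "q = (\<lambda>x. Re (cdot x (H *v x)))"
  \<comment> \<open>The eigenvector is a maximiser of the quadratic form on the unit sphere of \<open>W\<close>.\<close>
  have "closed W"
  proof -
    have "W = (\<Inter>i\<in>I. {x. cdot (u i) x = 0})"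
      by (auto simp: W_def)
    moreover have "closed {x. cdot (u i) x = 0}" for i
      by (intro closed_Collect_eq continuous_intros)
    ultimately show ?thesis by auto
  qed
  then have cpt: "compact (sphere 0 1 \<inter> W)"
    by (intro compact_Int_closed compact_sphere)
  obtain w where w0: "w \<noteq> 0" and wW: "\<And>i. i \<in> I \<Longrightarrow> cdot (u i) w = 0"
    by (rule exists_orthogonal_nonzero[OF on]) blast
  then have w: "w \<noteq> 0" "w \<in> W"
    by (simp_all add: W_def)
  define e where "e = of_real (1 / norm w) *s w"
  have scW: "c *s y \<in> W" if "y \<in> W" for c y
    using that by (simp add: W_def cdot_scale)
  have "e \<in> sphere 0 1 \<inter> W"
    using w by (auto simp: e_def norm_vector_smult scW norm_divide)
  then have ne: "sphere 0 1 \<inter> W \<noteq> {}" by blast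
  have "continuous_on (sphere 0 1 \<inter> W) q"
    unfolding q_def by (intro continuous_intros)
  from continuous_attains_sup[OF cpt ne this] obtain x where
    x: "norm x = 1" "x \<in> W" and max: "\<And>y. norm y = 1 \<Longrightarrow> y \<in> W \<Longrightarrow> q y \<le> q x"
    by auto
  define r where "r = q x"
  define g where "g = of_real r *s x - H *v x"
  \<comment> \<open>\<open>G\<close> is \<open>r I - H\<close>. Its form is nonnegative on
    \<open>W\<close> and vanishes at the maximiser \<open>x\<close>; a semidefinite form can vanish
    at \<open>x\<close> only if \<open>g = G x\<close> is zero, which is the eigenvector
    equation.\<close>
  define G where "G = (\<lambda>y. of_real r *s y - H *v y)"
  have qG: "Re (cdot y (G y)) = r * (norm y)\<^sup>2 - q y" for y
    by (simp add: G_def q_def cdot_diff cdot_scale cdot_self flip: of_real_mult of_real_power)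
  have pos: "0 \<le> Re (cdot y (G y))" if "y \<in> W" for y
  proof (cases "y = 0")
    case False
    define c where "c = complex_of_real (1 / norm y)"
    have "q (c *s y) \<le> r"
      unfolding r_def using False that by (intro max) (auto simp: norm_vector_smult scW c_def norm_divide)
    moreover have "q (c *s y) = q y / (norm y)\<^sup>2"
      by (simp add: q_def vec.scale cdot_scale c_def power2_eq_square)
    ultimately show ?thesis
      using False by (simp add: qG field_simps)
  qed (simp add: G_def)
  \<comment> \<open>\<open>W\<close> is the orthogonal complement of eigenvectors of a Hermitian
    matrix, hence invariant under \<open>H\<close>. This keeps \<open>g\<close> inside
    \<open>W\<close>, where \<open>x\<close> may be perturbed.\<close>
  have HW: "H *v y \<in> W" if "y \<in> W" for y
    unfolding W_def
  proof clarify
    fix i assume "i \<in> I"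
    then have "cdot (u i) (H *v y) = of_real (d i) * cdot (u i) y"
      by (simp add: ev cdot_scale flip: cdot_hermitian[OF H])
    then show "cdot (u i) (H *v y) = 0"
      using \<open>i \<in> I\<close> that by (simp add: W_def)
  qed
  have diffW: "a - b \<in> W" if "a \<in> W" "b \<in> W" for a b
    using that by (simp add: W_def cdot_diff)
  have gW: "g \<in> W"
    using x HW scW by (auto simp: g_def intro: diffW)
  have g: "g = G x" by (simp add: g_def G_def)
  have Gadj: "cdot a (G b) = cdot (G a) b" for a b
    by (simp add: G_def cdot_diff cdot_scale cdot_hermitian[OF H])
  have gg: "cdot x (G x) = 0"
  proof -
    have "cnj (cdot x (G x)) = cdot x (G x)"
      by (simp only: cnj_cdot Gadj)
    then have "Im (cdot x (G x)) = 0"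
      by (simp add: complex_eq_iff)
    moreover have "Re (cdot x (G x)) = 0"
      by (simp add: qG x r_def)
    ultimately show ?thesis by (simp add: complex_eq_iff)
  qed
  have "norm g = 0"
  proof (rule ccontr)
    assume ng: "norm g \<noteq> 0"
    define K where "K = Re (cdot g (G g))"
    \<comment> \<open>The form of \<open>G\<close> at the perturbed vector \<open>x - t g\<close>:
      the constant term is zero, and the linear term in \<open>t\<close> is strictly negative for
      \<open>t > 0\<close> if \<open>g\<close> is nonzero.\<close>
    have quad: "0 \<le> - 2 * t * (norm g)\<^sup>2 + t\<^sup>2 * K" for t
    proof -
      define y where "y = x - of_real t *s g"
      have "y \<in> W" unfolding y_def using x gW scW diffW by blast
      have "G y = G x - of_real t *s G g"
        by (simp add: G_def y_def vec.diff vec.scale vec_eq_iff algebra_simps)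
      then have Gy: "G y = g - of_real t *s G g"
        by (simp only: g)
      have "cdot x (G g) = cdot g g" using Gadj[of x g] by (simp add: g)
      then have "cdot y (G y) = - 2 * of_real t * of_real ((norm g)\<^sup>2) + (of_real t)\<^sup>2 * cdot g (G g)"
        unfolding Gy using gg
        by (simp add: y_def cdot_diff cdot_scale cdot_self flip: g)
          (simp add: algebra_simps power2_eq_square)
      then have "Re (cdot y (G y)) = - 2 * t * (norm g)\<^sup>2 + t\<^sup>2 * K"
        by (simp add: K_def flip: of_real_mult of_real_power)
      then show ?thesis using pos[OF \<open>y \<in> W\<close>] by simp
    qed
    \<comment> \<open>So small that the quadratic term is at most
      \<open>t * (norm g)\<^sup>2\<close>, half the size of the linear one. The added 1 keeps the
      denominator positive when \<open>K = 0\<close>.\<close>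
    define t where "t = (norm g)\<^sup>2 / (\<bar>K\<bar> + 1)"
    have t: "t > 0" using ng by (simp add: t_def)
    have "t * K \<le> t * (\<bar>K\<bar> + 1)" using t by (intro mult_left_mono) auto
    also have "\<dots> = (norm g)\<^sup>2" by (simp add: t_def)
    finally have "t * (t * K) \<le> t * (norm g)\<^sup>2" using t by simp
    moreover have "0 < t * (norm g)\<^sup>2" using t ng by simp
    ultimately show False using quad[of t] by (simp add: power2_eq_square)
  qed
  then have "H *v x = of_real r *s x" by (simp add: g_def)
  then show ?thesis
    using x that[of x r] by (auto simp: W_def cdot_self)
qed

lemma hermitian_eigenbasis:
  fixes H :: "complex^'n^'n"
  assumes "hermitian H"
  obtains u d where "eigenbasis H u d"
proof -
  \<comment> \<open>Induction on a subset of the index type: each new index receives an eigenvector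
    orthogonal to those already found, and \<open>I = UNIV\<close> gives the full basis.\<close>
  have "\<exists>u d. orthonormal I u \<and> (\<forall>i\<in>I. H *v u i = of_real (d i) *s u i)" for I :: "'n set"
  proof (induction I rule: finite_induct[OF finite])
    case 1
    then show ?case by (auto simp: orthonormal_def)
  next
    case (2 i I)
    then obtain u d where u: "orthonormal I u" "\<And>j. j \<in> I \<Longrightarrow> H *v u j = of_real (d j) *s u j"
      by auto
    have "card I < card (insert i I)" using 2 by simp
    also have "\<dots> \<le> CARD('n)" by (intro card_mono) auto
    finally obtain x r where x: "cdot x x = 1" "\<And>i. i \<in> I \<Longrightarrow> cdot (u i) x = 0"
        "H *v x = of_real r *s x"
      using exists_eigenvector_orthogonal[OF assms u(1) \<open>finite I\<close> _ u(2)] by blast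
    have x': "cdot x (u j) = 0" if "j \<in> I" for j
      using x(2)[OF that] cnj_cdot[of "u j" x] by simp
    have "orthonormal (insert i I) (u(i := x))"
      using u(1) x x' 2 by (auto simp: orthonormal_def)
    moreover have "\<forall>j\<in>insert i I. H *v (u(i := x)) j = of_real ((d(i := r)) j) *s (u(i := x)) j"
      using u(2) x 2 by auto
    ultimately show ?case by blast
  qed
  from this[of UNIV] that show ?thesis by (auto simp: eigenbasis_def)
qed

text \<open>The remainder \<open>w\<close> is orthogonal to every \<open>u i\<close>, hence to their
  span. By dimension the span is the whole space, so \<open>w\<close> is orthogonal to
  itself.\<close>

lemma orthonormal_expansion:
  fixes u :: "'n \<Rightarrow> complex^'n"
  assumes "orthonormal UNIV u"
  shows "x = (\<Sum>i\<in>UNIV. cdot (u i) x *s u i)"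
proof -
  define w where "w = x - (\<Sum>i\<in>UNIV. cdot (u i) x *s u i)"
  have orth: "cdot (u i) w = 0" for i
  proof -
    have "(\<Sum>j\<in>UNIV. cdot (u j) x * cdot (u i) (u j)) = (\<Sum>j\<in>UNIV. if i = j then cdot (u j) x else 0)"
      using assms by (intro sum.cong) (auto simp: orthonormal_def)
    then show ?thesis
      by (simp add: w_def cdot_diff cdot_sum cdot_scale)
  qed
  have "vec.span (range u) = UNIV"
    using orthonormal_dim_span[OF assms] vec.dim_eq_full[of "range u"]
    by (simp add: card_cart_basis vec.dimension_def)
  moreover have "cdot y w = 0" if "y \<in> vec.span (range u)" for y
    using that
  proof (rule vec.span_induct)
    show "vec.subspace {y. cdot y w = 0}"
      by (simp add: vec.subspace_def cdot_add cdot_scale)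
  qed (use orth in auto)
  ultimately have "cdot w w = 0" by simp
  then show ?thesis by (simp add: w_def)
qed

lemma eigenbasis_form:
  assumes "eigenbasis H u d"
  shows "cdot x (H *v x) = of_real (\<Sum>i\<in>UNIV. d i * (cmod (cdot (u i) x))\<^sup>2)"
proof -
  have on: "orthonormal UNIV u" and ev: "\<And>i. H *v u i = of_real (d i) *s u i"
    using assms by (auto simp: eigenbasis_def)
  have "H *v x = (\<Sum>i\<in>UNIV. cdot (u i) x *s (of_real (d i) *s u i))"
    by (subst orthonormal_expansion[OF on, of x]) (simp add: vec.sum vec.scale ev)
  then have "cdot x (H *v x) = (\<Sum>i\<in>UNIV. cdot (u i) x * (of_real (d i) * cdot x (u i)))"
    by (simp add: cdot_sum cdot_scale mult.assoc)
  also have "\<dots> = (\<Sum>i\<in>UNIV. of_real (d i * (cmod (cdot (u i) x))\<^sup>2))"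
    by (intro sum.cong refl)
      (simp add: complex_norm_square cnj_cdot algebra_simps del: of_real_power)
  finally show ?thesis by simp
qed

text \<open>Follows from the spectral decomposition of \<open>\<sigma>\<close> into rank-one terms
  weighted by \<open>d i\<close>, which \<open>entry\<close> records entry by entry. For
  \<open>M = mat 1\<close> it says that the trace is the sum of the eigenvalues.\<close>

lemma eigenbasis_trace:
  fixes M :: "complex^'n^'n"
  assumes "eigenbasis \<sigma> u d"
  shows "trace (M ** \<sigma>) = (\<Sum>i\<in>UNIV. of_real (d i) * cdot (u i) (M *v u i))"
proof -
  have on: "orthonormal UNIV u" and ev: "\<And>i. \<sigma> *v u i = of_real (d i) *s u i"
    using assms by (auto simp: eigenbasis_def)
  have ax: "cdot y (axis k 1) = cnj (y $ k)" for y :: "complex^'n" and k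
    by (simp add: cdot_def axis_def if_distrib cong: if_cong)
  have entry: "\<sigma> $ j $ k = (\<Sum>i\<in>UNIV. of_real (d i) * u i $ j * cnj (u i $ k))" for j k
  proof -
    have "\<sigma> $ j $ k = (\<sigma> *v axis k 1) $ j"
      by (simp add: matrix_vector_mult_def axis_def if_distrib cong: if_cong)
    also have "\<sigma> *v axis k 1 = (\<Sum>i\<in>UNIV. cnj (u i $ k) *s (of_real (d i) *s u i))"
      by (subst orthonormal_expansion[OF on, of "axis k 1"]) (simp add: vec.sum vec.scale ev ax)
    finally show ?thesis by (simp add: algebra_simps)
  qed
  have "trace (M ** \<sigma>) = (\<Sum>k\<in>UNIV. \<Sum>j\<in>UNIV. \<Sum>i\<in>UNIV. of_real (d i) * (cnj (u i $ k) * (M $ k $ j * u i $ j)))"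
    by (simp add: trace_def matrix_matrix_mult_def entry sum_distrib_left algebra_simps)
  also have "\<dots> = (\<Sum>k\<in>UNIV. \<Sum>i\<in>UNIV. \<Sum>j\<in>UNIV. of_real (d i) * (cnj (u i $ k) * (M $ k $ j * u i $ j)))"
    by (intro sum.cong refl sum.swap)
  also have "\<dots> = (\<Sum>i\<in>UNIV. \<Sum>k\<in>UNIV. \<Sum>j\<in>UNIV. of_real (d i) * (cnj (u i $ k) * (M $ k $ j * u i $ j)))"
    by (rule sum.swap)
  also have "\<dots> = (\<Sum>i\<in>UNIV. of_real (d i) * cdot (u i) (M *v u i))"
    by (simp add: cdot_def matrix_vector_mult_def sum_distrib_left)
  finally show ?thesis .
qed

subsection \<open>Counting negative eigenvalues\<close>

lemma const_poly_sum: "[:\<Sum>i\<in>I. f i:] = (\<Sum>i\<in>I. [:f i:])"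
proof (induction I rule: infinite_finite_induct)
  case (insert i I)
  have "[:f i + sum f I:] = [:f i:] + [:sum f I:]" by simp
  with insert show ?case by (simp del: add_pCons)
qed simp_all

text \<open>Diagonalisation over the polynomial ring: \<open>U\<close> has the eigenvectors as
  constant columns, \<open>V\<close> is its conjugate transpose, and \<open>C ** U = U ** D\<close>.
  From \<open>V ** U = mat 1\<close> the determinant of \<open>U\<close> is nonzero and
  cancels.\<close>

lemma eigenbasis_charpoly:
  fixes H :: "complex^'n^'n"
  assumes "eigenbasis H u d"
  shows "charpoly H = (\<Prod>i\<in>UNIV. [:- of_real (d i), 1:])"
proof -
  have on: "cdot (u i) (u j) = (if i = j then 1 else 0)" for i j
    using assms by (simp add: eigenbasis_def orthonormal_def)
  have ev: "(\<Sum>k\<in>UNIV. H $ i $ k * u j $ k) = of_real (d j) * u j $ i" for i j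
  proof -
    have "(H *v u j) $ i = of_real (d j) * u j $ i"
      using assms by (simp add: eigenbasis_def)
    then show ?thesis by (simp add: matrix_vector_mult_def)
  qed
  define C :: "complex poly^'n^'n"
    where "C = (\<chi> i j. (if i = j then [:0, 1:] else 0) - [:H $ i $ j:])"
  define D :: "complex poly^'n^'n"
    where "D = (\<chi> i j. if i = j then [:- of_real (d i), 1:] else 0)"
  define U :: "complex poly^'n^'n" where "U = (\<chi> i j. [:u j $ i:])"
  define V :: "complex poly^'n^'n" where "V = (\<chi> i j. [:cnj (u i $ j):])"
  have "(V ** U) $ i $ j = mat 1 $ i $ j" for i j
    using on[of i j]
    by (simp add: V_def U_def matrix_matrix_mult_def mat_def cdot_def one_pCons mult.commute
        flip: const_poly_sum)
  then have "V ** U = mat 1" by (simp add: vec_eq_iff)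
  then have "det V * det U = 1" by (metis det_I det_mul)
  then have U0: "det U \<noteq> 0" by auto
  have "(C ** U) $ i $ j = (U ** D) $ i $ j" for i j
  proof -
    have "(C ** U) $ i $ j =
        (\<Sum>k\<in>UNIV. (if i = k then [:0, 1:] * [:u j $ k:] else 0) - [:H $ i $ k * u j $ k:])"
      unfolding C_def U_def matrix_matrix_mult_def
      by (simp del: mult_pCons_left mult_pCons_right, intro sum.cong refl) (simp add: left_diff_distrib)
    also have "\<dots> = [:0, 1:] * [:u j $ i:] - [:\<Sum>k\<in>UNIV. H $ i $ k * u j $ k:]"
      by (simp add: sum_subtractf const_poly_sum)
    also have "\<dots> = [:u j $ i:] * [:- of_real (d j), 1:]"
      by (simp add: ev)
    also have "\<dots> = (\<Sum>k\<in>UNIV. if k = j then [:u k $ i:] * [:- of_real (d k), 1:] else 0)"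
      by simp
    also have "\<dots> = (U ** D) $ i $ j"
      unfolding D_def U_def matrix_matrix_mult_def
      by (simp only: vec_lambda_beta) (intro sum.cong refl, simp)
    finally show ?thesis .
  qed
  then have "C ** U = U ** D" by (simp add: vec_eq_iff)
  then have "det C * det U = det U * det D" by (metis det_mul)
  then have "det C = det D" using U0 by simp
  also have "\<dots> = (\<Prod>i\<in>UNIV. [:- of_real (d i), 1:])"
    by (subst det_diagonal) (auto simp: D_def)
  finally show ?thesis by (simp add: charpoly_def C_def)
qed

lemma eigenbasis_num_neg_eigenvalues:
  assumes "eigenbasis H u d"
  shows "num_neg_eigenvalues H = card {i. d i < 0}"
proof -
  have roots: "proots (charpoly H) = (\<Sum>i\<in>UNIV. {#of_real (d i)#})"
    by (simp add: eigenbasis_charpoly[OF assms] proots_prod)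
  have "size (filter_mset (\<lambda>z. z \<in> \<real> \<and> Re z < 0) (\<Sum>i\<in>I. {#complex_of_real (d i)#})) =
      card {i\<in>I. d i < 0}" if "finite I" for I
    using that
  proof (induction I rule: finite_induct)
    case (insert i I)
    have "{j \<in> insert i I. d j < 0} = (if d i < 0 then insert i {j\<in>I. d j < 0} else {j\<in>I. d j < 0})"
      by auto
    then show ?case using insert by simp
  qed simp
  from this[of UNIV] show ?thesis
    by (simp add: num_neg_eigenvalues_def roots)
qed

lemma orthonormal_span_coeff_zero:
  assumes "orthonormal UNIV u" "x \<in> vec.span (u ` I)" "i \<notin> I"
  shows "cdot (u i) x = 0"
  using assms(2)
proof (rule vec.span_induct)
  show "vec.subspace {x. cdot (u i) x = 0}"
    by (simp add: vec.subspace_def cdot_add cdot_scale)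
  show "cdot (u i) x = 0" if "x \<in> u ` I" for x
    using that assms(1,3) by (auto simp: orthonormal_def)
qed

definition negative_on :: "complex^'n^'n \<Rightarrow> (complex^'n) set \<Rightarrow> bool" where
  "negative_on H S \<longleftrightarrow> vec.subspace S \<and> (\<forall>x\<in>S. x \<noteq> 0 \<longrightarrow> Re (cdot x (H *v x)) < 0)"

text \<open>The span of the eigenvectors with negative eigenvalue works: the other coefficients of
  its vectors vanish, and a nonzero vector has some nonzero coefficient, which makes the sum
  strictly negative.\<close>

lemma exists_negative_on_num_neg:
  assumes "hermitian H"
  obtains S where "negative_on H S" "vec.dim S = num_neg_eigenvalues H"
proof -
  obtain u d where ud: "eigenbasis H u d"
    using hermitian_eigenbasis[OF assms] by blast
  then have on: "orthonormal UNIV u" by (simp add: eigenbasis_def)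
  let ?I = "{i. d i < 0}"
  let ?S = "vec.span (u ` ?I)"
  have "Re (cdot x (H *v x)) < 0" if "x \<in> ?S" "x \<noteq> 0" for x
  proof -
    have z: "cdot (u i) x = 0" if "\<not> d i < 0" for i
      using orthonormal_span_coeff_zero[OF on \<open>x \<in> ?S\<close>] that by simp
    obtain i where i: "cdot (u i) x \<noteq> 0"
      using orthonormal_expansion[OF on, of x] \<open>x \<noteq> 0\<close> by fastforce
    have "(\<Sum>i\<in>UNIV. d i * (cmod (cdot (u i) x))\<^sup>2) < (\<Sum>i\<in>(UNIV::'a set). 0)"
    proof (rule sum_strict_mono_ex1)
      show "\<forall>i\<in>UNIV. d i * (cmod (cdot (u i) x))\<^sup>2 \<le> 0"
        using z by (metis less_imp_le mult_nonpos_nonneg mult_zero_right norm_zero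
            power_zero_numeral order_refl zero_le_power2)
      have "d i < 0" using z i by blast
      then show "\<exists>i\<in>UNIV. d i * (cmod (cdot (u i) x))\<^sup>2 < 0"
        using i by (intro bexI[of _ i]) (auto simp: mult_neg_pos)
    qed simp
    then show ?thesis by (simp add: eigenbasis_form[OF ud])
  qed
  then have "negative_on H ?S" by (simp add: negative_on_def)
  moreover have "vec.dim ?S = num_neg_eigenvalues H"
    using orthonormal_dim_span[OF orthonormal_subset[OF on subset_UNIV], of ?I]
    by (simp add: eigenbasis_num_neg_eigenvalues[OF ud])
  ultimately show ?thesis by (rule that)
qed

text \<open>The form is nonnegative on the span \<open>?P\<close> of the remaining eigenvectors, so
  \<open>S\<close> meets \<open>?P\<close> only in zero, and the dimension formula bounds
  \<open>vec.dim S\<close> by the codimension of \<open>?P\<close>.\<close>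

lemma negative_on_dim_le:
  fixes H :: "complex^'n^'n"
  assumes "hermitian H" "negative_on H S"
  shows "vec.dim S \<le> num_neg_eigenvalues H"
proof -
  obtain u d where ud: "eigenbasis H u d"
    using hermitian_eigenbasis[OF assms(1)] by blast
  then have on: "orthonormal UNIV u" by (simp add: eigenbasis_def)
  let ?I = "{i. d i < 0}"
  let ?P = "vec.span (u ` (- ?I))"
  have nonneg: "0 \<le> Re (cdot x (H *v x))" if "x \<in> ?P" for x
  proof -
    have "cdot (u i) x = 0" if "d i < 0" for i
      using orthonormal_span_coeff_zero[OF on \<open>x \<in> ?P\<close>] that by simp
    then have "0 \<le> d i * (cmod (cdot (u i) x))\<^sup>2" for i
      by (cases "d i < 0") auto
    then show ?thesis by (simp add: eigenbasis_form[OF ud] sum_nonneg)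
  qed
  have "S \<inter> ?P = {0}"
  proof -
    have "x = 0" if "x \<in> S" "x \<in> ?P" for x
      using nonneg[OF that(2)] assms(2) that(1) by (force simp: negative_on_def)
    moreover have "0 \<in> S \<inter> ?P"
      using assms(2) by (simp add: negative_on_def vec.subspace_0 vec.span_zero)
    ultimately show ?thesis by auto
  qed
  then have "vec.dim (S \<inter> ?P) = 0" by simp
  then have "vec.dim S + vec.dim ?P = vec.dim {x + y |x y. x \<in> S \<and> y \<in> ?P}"
    using vec.dim_sums_Int[of S ?P] assms(2)
    by (simp add: negative_on_def del: vec.dim_eq_0 vec.dim_span)
  also have "\<dots> \<le> CARD('n)" by (rule dim_subset_UNIV_cart_gen)
  also have "\<dots> = card ?I + card (- ?I)"
    by (subst card_Un_disjoint[symmetric]) (auto simp: Compl_partition)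
  also have "card (- ?I) = vec.dim ?P"
    using orthonormal_dim_span[OF orthonormal_subset[OF on subset_UNIV], of "- ?I"] by simp
  finally show ?thesis by (simp add: eigenbasis_num_neg_eigenvalues[OF ud])
qed

subsection \<open>Positive semidefinite matrices\<close>

lemma trace_eq_sum: "trace (A ** B) = (\<Sum>i\<in>UNIV. \<Sum>j\<in>UNIV. A $ i $ j * B $ j $ i)"
  by (simp add: trace_def matrix_matrix_mult_def)

lemma scaleR_matrix_vector_mult: "(c *\<^sub>R A) *v x = of_real c *s (A *v x)" for A :: "complex^'n^'m"
  by (simp add: vec_eq_iff matrix_vector_mult_def sum_distrib_left mult.assoc scaleR_conv_of_real[where 'a=complex])

lemma scaleR_eq_mscale: "c *\<^sub>R A = mscale (of_real c) A"
  by (simp add: vec_eq_iff mscale_def scaleR_conv_of_real[where 'a=complex])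

lemma trace_scaleR: "trace (c *\<^sub>R A) = of_real c * trace A" for A :: "complex^'n^'n"
  by (simp add: trace_def scaleR_conv_of_real[where 'a=complex] sum_distrib_left)

lemma psd_zero: "psd 0"
  by (simp add: psd_iff hermitian_def ctranspose_def vec_eq_iff)

lemma psd_add: "psd A \<Longrightarrow> psd B \<Longrightarrow> psd (A + B)"
  by (simp add: psd_iff hermitian_def ctranspose_def vec_eq_iff matrix_vector_mult_add_rdistrib cdot_add)

lemma psd_scaleR: "psd A \<Longrightarrow> 0 \<le> c \<Longrightarrow> psd (c *\<^sub>R A)"
  by (simp add: psd_iff hermitian_def ctranspose_def vec_eq_iff scaleR_matrix_vector_mult cdot_scale)

lemma closed_psd: "closed {A :: complex^'n^'n. psd A}"
proof -
  have "{A :: complex^'n^'n. psd A} =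
      {A. (\<forall>i j. cnj (A $ j $ i) = A $ i $ j) \<and> (\<forall>x. 0 \<le> Re (cdot x (A *v x)))}"
    by (auto simp: psd_iff hermitian_def ctranspose_def vec_eq_iff)
  also have "closed \<dots>"
    by (intro closed_Collect_conj closed_Collect_all closed_Collect_eq closed_Collect_le
        continuous_intros)
  finally show ?thesis .
qed

lemma convex_psd: "convex {A. psd A}"
  by (auto simp: convex_def intro: psd_add psd_scaleR)

text \<open>The rank-one matrix of \<open>x\<close> times its conjugate transpose; for a unit
  vector, the orthogonal projection onto its line. Pairing with it under the trace recovers the
  quadratic form at \<open>x\<close>.\<close>

definition outer :: "complex^'n \<Rightarrow> complex^'n^'n" where
  "outer x = (\<chi> i j. x $ i * cnj (x $ j))"

lemma outer_mult: "outer x *v y = cdot x y *s x"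
  by (simp add: vec_eq_iff outer_def matrix_vector_mult_def cdot_def sum_distrib_left
      algebra_simps)

lemma trace_mult_outer: "trace (M ** outer x) = cdot x (M *v x)"
  by (simp add: trace_eq_sum outer_def cdot_def matrix_vector_mult_def sum_distrib_left
      algebra_simps)

lemma psd_outer: "psd (outer x)"
proof -
  have "cdot y (outer x *v y) = of_real ((cmod (cdot x y))\<^sup>2)" for y
    by (simp add: outer_mult cdot_scale complex_norm_square cnj_cdot del: of_real_power)
  then show ?thesis
    by (simp add: psd_iff hermitian_def ctranspose_def outer_def vec_eq_iff mult.commute)
qed

lemma density_matrix_outer:
  assumes "norm x = 1"
  shows "density_matrix (outer x)"
  using trace_mult_outer[of "mat 1" x] assms
  by (simp add: density_matrix_def psd_outer matrix_mul_lid cdot_self)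

lemma supp_outer: "vec.subspace S \<Longrightarrow> x \<in> S \<Longrightarrow> supp (outer x) \<subseteq> S"
  by (auto simp: supp_def outer_mult vec.subspace_scale)

lemma convex_density_supp:
  assumes "vec.subspace S"
  shows "convex {\<sigma>. density_matrix \<sigma> \<and> supp \<sigma> \<subseteq> S}"
proof (rule convexI, clarify, intro conjI)
  fix A B :: "complex^'a^'a" and u v :: real
  assume uv: "0 \<le> u" "0 \<le> v" "u + v = 1"
    and AB: "density_matrix A" "supp A \<subseteq> S" "density_matrix B" "supp B \<subseteq> S"
  have "complex_of_real u + of_real v = 1"
    using uv by (metis of_real_1 of_real_add)
  then show "density_matrix (u *\<^sub>R A + v *\<^sub>R B)"
    using AB uv by (simp add: density_matrix_def psd_add psd_scaleR trace_add trace_scaleR)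
  show "supp (u *\<^sub>R A + v *\<^sub>R B) \<subseteq> S"
    using AB assms
    by (auto simp: supp_def matrix_vector_mult_add_rdistrib scaleR_matrix_vector_mult
        intro!: vec.subspace_add vec.subspace_scale)
qed

section \<open>Trace pairings with positive semidefinite matrices, evaluated in an
  eigenbasis\<close>

lemma psd_eigenvalue_nonneg:
  assumes "eigenbasis A u d" "psd A"
  shows "0 \<le> d i"
proof -
  have "cdot (u i) (A *v u i) = of_real (d i)"
    using assms(1) by (simp add: eigenbasis_def orthonormal_def cdot_scale)
  then show ?thesis using assms(2) by (metis Re_complex_of_real psd_iff)
qed

text \<open>One half of the self-duality of the cone: in an eigenbasis of \<open>\<sigma>\<close>
  the trace is a sum of values of the form of \<open>P\<close> with nonnegative weights.\<close>

lemma trace_psd_mult_nonneg: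
  assumes "psd P" "psd \<sigma>"
  shows "0 \<le> Re (trace (P ** \<sigma>))"
proof -
  obtain u d where ud: "eigenbasis \<sigma> u d"
    using hermitian_eigenbasis[of \<sigma>] assms(2) unfolding psd_iff by blast
  show ?thesis
    using assms(1) psd_eigenvalue_nonneg[OF ud assms(2)]
    by (auto simp: eigenbasis_trace[OF ud] psd_iff intro!: sum_nonneg)
qed

text \<open>The trace is the sum of the eigenvalues. A nonzero pairing with any \<open>M\<close>
  forces some eigenvalue to be nonzero, hence positive, so \<open>\<sigma>\<close> can be normalised
  to trace 1.\<close>

lemma psd_trace:
  assumes "psd \<sigma>"
  shows "trace \<sigma> = of_real (Re (trace \<sigma>))"
    and "trace (M ** \<sigma>) \<noteq> 0 \<Longrightarrow> 0 < Re (trace \<sigma>)"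
proof -
  obtain u d where ud: "eigenbasis \<sigma> u d"
    using hermitian_eigenbasis[of \<sigma>] assms unfolding psd_iff by blast
  then have "trace \<sigma> = (\<Sum>i\<in>UNIV. of_real (d i))"
    using eigenbasis_trace[OF ud, of "mat 1"]
    by (simp add: matrix_mul_lid eigenbasis_def orthonormal_def)
  then have tr: "trace \<sigma> = of_real (\<Sum>i\<in>UNIV. d i)" by simp
  then show "trace \<sigma> = of_real (Re (trace \<sigma>))" by simp
  assume "trace (M ** \<sigma>) \<noteq> 0"
  then obtain i where "d i \<noteq> 0"
    by (cases "\<exists>i. d i \<noteq> 0") (auto simp: eigenbasis_trace[OF ud])
  then have "0 < (\<Sum>i\<in>UNIV. d i)"
    using psd_eigenvalue_nonneg[OF ud assms]
    by (intro sum_pos2[of _ i]) (auto simp: less_le)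
  then show "0 < Re (trace \<sigma>)" by (simp add: tr)
qed

text \<open>In an eigenbasis of \<open>\<sigma>\<close> the trace is a nonnegative combination of
  values of the form of \<open>H\<close>, and only eigenvectors inside the support carry a nonzero
  weight.\<close>

lemma trace_negative_on_less_0:
  assumes "negative_on H S" "density_matrix \<sigma>" "supp \<sigma> \<subseteq> S"
  shows "Re (trace (H ** \<sigma>)) < 0"
proof -
  have psd: "psd \<sigma>" and tr: "trace \<sigma> = 1"
    using assms(2) by (auto simp: density_matrix_def)
  obtain u d where ud: "eigenbasis \<sigma> u d"
    using hermitian_eigenbasis[of \<sigma>] psd unfolding psd_iff by blast
  have nn: "0 \<le> d i" for i
    by (rule psd_eigenvalue_nonneg[OF ud psd])
  have neg: "Re (cdot (u i) (H *v u i)) < 0" if "d i \<noteq> 0" for i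
  proof -
    \<comment> \<open>Dividing by the nonzero eigenvalue exhibits \<open>u i\<close> itself as an
      element of the range of \<open>\<sigma>\<close>.\<close>
    have "\<sigma> *v u i \<in> S" using assms(3) by (auto simp: supp_def)
    then have "of_real (1 / d i) *s (\<sigma> *v u i) \<in> S"
      using assms(1) by (intro vec.subspace_scale) (simp_all add: negative_on_def)
    moreover have "of_real (1 / d i) *s (\<sigma> *v u i) = u i"
      using ud that by (simp add: eigenbasis_def)
    moreover have "cdot (u i) (u i) = 1"
      using ud by (simp add: eigenbasis_def orthonormal_def)
    then have "u i \<noteq> 0" by auto
    ultimately show ?thesis using assms(1) by (simp add: negative_on_def)
  qed
  obtain i where "d i \<noteq> 0"
    using eigenbasis_trace[OF ud, of "mat 1"] tr by (cases "\<exists>i. d i \<noteq> 0") auto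
  have "(\<Sum>i\<in>UNIV. d i * Re (cdot (u i) (H *v u i))) < (\<Sum>i\<in>(UNIV::'a set). 0)"
  proof (rule sum_strict_mono_ex1)
    show "\<forall>i\<in>UNIV. d i * Re (cdot (u i) (H *v u i)) \<le> 0"
    proof
      show "d i * Re (cdot (u i) (H *v u i)) \<le> 0" for i
        using nn[of i] neg[of i] by (cases "d i = 0") (auto simp: mult_nonneg_nonpos)
    qed
    show "\<exists>i\<in>UNIV. d i * Re (cdot (u i) (H *v u i)) < 0"
      using nn[of i] neg[of i] \<open>d i \<noteq> 0\<close> by (intro bexI[of _ i]) (auto simp: mult_pos_neg)
  qed simp
  then show ?thesis by (simp add: eigenbasis_trace[OF ud])
qed

subsection \<open>The adjoint of an ampliation\<close>

text \<open>Both sides are complex bilinear and every matrix is \<open>H + mscale \<i> K\<close>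
  with Hermitian parts, so the identity extends beyond Hermitian matrices. The blocks of a Hermitian
  matrix on the tensor product require this generality.\<close>

lemma is_adjoint_map_trace:
  fixes \<Phi> :: "complex^'n^'n \<Rightarrow> complex^'n^'n"
  assumes "Vector_Spaces.linear mscale mscale \<Phi>" "is_adjoint_map \<Phi> \<Psi>"
  shows "trace (X ** \<Phi> Y) = trace (\<Psi> X ** Y)"
proof -
  interpret F: Vector_Spaces.linear mscale mscale \<Phi> by fact
  interpret P: Vector_Spaces.linear mscale mscale \<Psi> using assms(2) by (simp add: is_adjoint_map_def)
  have adj: "trace (X ** \<Phi> Y) = trace (\<Psi> X ** Y)" if "hermitian X" "hermitian Y" for X Y
    using assms(2) that by (simp add: is_adjoint_map_def)
  have add: "trace ((A + B) ** C) = trace (A ** C) + trace (B ** C)"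
    "trace (C ** (A + B)) = trace (C ** A) + trace (C ** B)"
    "trace (mscale c A ** C) = c * trace (A ** C)"
    "trace (C ** mscale c A) = c * trace (C ** A)" for A B C :: "complex^'n^'n" and c
    by (simp_all add: trace_eq_sum mscale_def algebra_simps sum.distrib sum_distrib_left)
  obtain H K where "hermitian H" "hermitian K" "X = H + mscale \<i> K"
    by (rule hermitian_cases)
  moreover obtain H' K' where "hermitian H'" "hermitian K'" "Y = H' + mscale \<i> K'"
    by (rule hermitian_cases)
  ultimately show ?thesis
    by (simp add: F.add F.scale P.add P.scale add adj)
qed

text \<open>The trace of a product splits into traces of products of blocks, and both ampliations
  act block by block.\<close>

lemma trace_id_tensor_adjoint:
  fixes \<Phi> :: "complex^'n^'n \<Rightarrow> complex^'n^'n"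
    and X Y :: "complex^('m::finite \<times> 'n)^('m \<times> 'n)"
  assumes "Vector_Spaces.linear mscale mscale \<Phi>" "is_adjoint_map \<Phi> \<Psi>"
  shows "trace (X ** id_tensor \<Phi> Y) = trace (id_tensor \<Psi> X ** Y)"
proof -
  define blk where "blk = (\<lambda>X :: complex^('m \<times> 'n)^('m \<times> 'n). \<lambda>i j. \<chi> k l. X $ (i, k) $ (j, l))"
  have prod: "(\<Sum>p\<in>UNIV. f p) = (\<Sum>i\<in>UNIV. \<Sum>k\<in>UNIV. f (i, k))" for f :: "'m \<times> 'n \<Rightarrow> complex"
    by (simp add: sum.cartesian_product)
  have tr: "trace (X ** Z) = (\<Sum>i\<in>UNIV. \<Sum>j\<in>UNIV. trace (blk X i j ** blk Z j i))" for X Z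
  proof -
    have "trace (X ** Z) =
        (\<Sum>i\<in>UNIV. \<Sum>k\<in>UNIV. \<Sum>j\<in>UNIV. \<Sum>l\<in>UNIV. X $ (i, k) $ (j, l) * Z $ (j, l) $ (i, k))"
      by (simp only: trace_eq_sum prod)
    also have "\<dots> =
        (\<Sum>i\<in>UNIV. \<Sum>j\<in>UNIV. \<Sum>k\<in>UNIV. \<Sum>l\<in>UNIV. X $ (i, k) $ (j, l) * Z $ (j, l) $ (i, k))"
      by (intro sum.cong refl sum.swap)
    finally show ?thesis by (simp add: trace_eq_sum blk_def)
  qed
  have blk: "blk (id_tensor F Z) i j = F (blk Z i j)" for F Z i j
    by (simp add: blk_def id_tensor_def vec_eq_iff)
  show ?thesis
    by (simp add: tr blk is_adjoint_map_trace[OF assms])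
qed

text \<open>Opposite blocks of \<open>X\<close> are conjugate transposes of each other, and
  \<open>\<Phi>\<close> commutes with \<open>ctranspose\<close>.\<close>

lemma hermitian_id_tensor:
  assumes "Vector_Spaces.linear mscale mscale \<Phi>" "hermiticity_preserving \<Phi>" "hermitian X"
  shows "hermitian (id_tensor \<Phi> X)"
proof -
  have "cnj (\<Phi> (\<chi> k l. X $ (a, k) $ (b, l)) $ i $ j) = \<Phi> (\<chi> k l. X $ (b, k) $ (a, l)) $ j $ i"
    for a b i j
  proof -
    have "(\<chi> k l. X $ (b, k) $ (a, l)) = ctranspose (\<chi> k l. X $ (a, k) $ (b, l))"
      by (simp add: ctranspose_def hermitian_nth[OF assms(3)])
    then have "\<Phi> (\<chi> k l. X $ (b, k) $ (a, l)) = ctranspose (\<Phi> (\<chi> k l. X $ (a, k) $ (b, l)))"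
      by (simp only: linear_ctranspose[OF assms(1,2)])
    then show ?thesis by (simp add: ctranspose_def)
  qed
  then show ?thesis
    by (simp add: hermitian_def ctranspose_def id_tensor_def vec_eq_iff)
qed

lemma linear_mscale_imp_linear:
  assumes "Vector_Spaces.linear mscale mscale F"
  shows "linear F"
proof -
  interpret Vector_Spaces.linear mscale mscale F by fact
  show ?thesis by (rule linearI) (simp_all add: add scale scaleR_eq_mscale)
qed

subsection \<open>Separation from the cone of positive semidefinite matrices\<close>

lemma inner_matrix: "inner A B = Re (trace (ctranspose A ** B))" for A B :: "complex^'n^'n"
proof -
  have "Re (trace (ctranspose A ** B)) = (\<Sum>i\<in>UNIV. \<Sum>j\<in>UNIV. inner (A $ j $ i) (B $ j $ i))"
    by (simp add: trace_eq_sum ctranspose_def inner_complex_def)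
  also have "\<dots> = (\<Sum>j\<in>UNIV. \<Sum>i\<in>UNIV. inner (A $ j $ i) (B $ j $ i))"
    by (rule sum.swap)
  finally show ?thesis by (simp add: inner_vec_def)
qed

text \<open>Turns a real functional \<open>inner A\<close> with arbitrary \<open>A\<close>, as
  produced by hyperplane separation, into a trace pairing with a Hermitian matrix; the
  anti-Hermitian part of \<open>A\<close> is invisible to Hermitian \<open>P\<close>.\<close>

lemma inner_hermitian:
  fixes A P :: "complex^'n^'n"
  assumes "hermitian P"
  shows "Re (trace ((A + ctranspose A) ** P)) = 2 * inner A P"
proof -
  have "inner (ctranspose A) P = inner (ctranspose A) (ctranspose P)"
    using assms by (simp add: hermitian_def)
  also have "\<dots> = (\<Sum>i\<in>UNIV. \<Sum>j\<in>UNIV. inner (A $ j $ i) (P $ j $ i))"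
    by (simp add: inner_vec_def ctranspose_def inner_complex_def)
  also have "\<dots> = (\<Sum>j\<in>UNIV. \<Sum>i\<in>UNIV. inner (A $ j $ i) (P $ j $ i))"
    by (rule sum.swap)
  also have "\<dots> = inner A P" by (simp add: inner_vec_def)
  finally have "inner (ctranspose A) P = inner A P" .
  moreover have "Re (trace ((A + ctranspose A) ** P)) = inner (ctranspose A) P + inner A P"
    by (simp add: inner_matrix trace_eq_sum ctranspose_def algebra_simps sum.distrib)
  ultimately show ?thesis by simp
qed

lemma non_positive_subspace_witness:
  fixes \<Phi> :: "complex^'n^'n \<Rightarrow> complex^'n^'n"
    and S :: "(complex^('m::finite \<times> 'n)) set"
  assumes lin: "Vector_Spaces.linear mscale mscale \<Phi>"
    and hp: "hermiticity_preserving \<Phi>"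
    and adj: "is_adjoint_map \<Phi> \<Psi>"
    and S: "non_positive_subspace \<Phi> S"
  obtains \<rho> where "density_matrix \<rho>" "negative_on (id_tensor \<Psi> \<rho>) S"
proof (cases "S \<subseteq> {0}")
  case True
  \<comment> \<open>With \<open>S\<close> trivial there is no unit vector in \<open>S\<close> and
    nothing to separate. Negativity is vacuous, so the projection onto an arbitrary basis vector
    serves.\<close>
  have "density_matrix (outer (axis undefined 1 :: complex^('m \<times> 'n)))"
    by (rule density_matrix_outer) (simp add: norm_axis_1)
  moreover have "negative_on H S" for H
    using True S by (auto simp: negative_on_def non_positive_subspace_def)
  ultimately show ?thesis by (rule that)
next
  case False
  have sub: "vec.subspace S" using S by (simp add: non_positive_subspace_def)
  have "subspace S"
  proof -
    have "c *\<^sub>R x = of_real c *s x" for c and x :: "complex^('m \<times> 'n)"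
      by (simp add: vec_eq_iff scaleR_conv_of_real[where 'a=complex])
    then show ?thesis
      using sub by (simp add: subspace_def vec.subspace_def)
  qed
  then have "compact (sphere 0 1 \<inter> S)"
    by (intro compact_Int_closed compact_sphere closed_subspace)
  moreover have "continuous_on (sphere 0 1 \<inter> S) outer"
    unfolding outer_def by (intro continuous_intros)
  ultimately have "compact (outer ` (sphere 0 1 \<inter> S))"
    by (rule compact_continuous_image[rotated])
  then have cpt: "compact (convex hull (outer ` (sphere 0 1 \<inter> S)))"
    by (rule compact_convex_hull)
  \<comment> \<open>By the spectral theorem \<open>?D\<close> is the whole set of density matrices supported in \<open>S\<close>, but
    only the inclusion \<open>D\<close> is needed; the convex hull form gives compactness at once.\<close>
  let ?D = "convex hull (outer ` (sphere 0 1 \<inter> S))"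
  let ?F = "id_tensor \<Phi> :: complex^('m \<times> 'n)^('m \<times> 'n) \<Rightarrow> _"
  have linF: "linear ?F"
    by (intro linear_mscale_imp_linear linear_id_tensor lin)
  have D: "?D \<subseteq> {\<sigma>. density_matrix \<sigma> \<and> supp \<sigma> \<subseteq> S}"
    by (intro hull_minimal convex_density_supp sub)
      (auto simp: density_matrix_outer dest: supp_outer[OF sub])
  have unit: "of_real (1 / norm x) *s x \<in> sphere 0 1 \<inter> S" if "x \<in> S" "x \<noteq> 0" for x
    using that sub by (auto simp: norm_vector_smult norm_divide intro: vec.subspace_scale)
  then have "sphere 0 1 \<inter> S \<noteq> {}" using False by blast
  then have ne: "?D \<noteq> {}" by simp
  have "?F ` ?D \<inter> {P. psd P} = {}"
    using D S by (auto simp: non_positive_subspace_def)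
  moreover have "compact (?F ` ?D)"
    using linF cpt by (intro compact_continuous_image linear_continuous_on)
      (simp_all add: linear_conv_bounded_linear)
  moreover have "convex (?F ` ?D)"
    by (intro convex_linear_image linF convex_convex_hull)
  ultimately obtain A b where A1: "\<And>\<sigma>. \<sigma> \<in> ?D \<Longrightarrow> inner A (?F \<sigma>) < b"
    and A2: "\<And>P. psd P \<Longrightarrow> b < inner A P"
    using separating_hyperplane_compact_closed[of "?F ` ?D" "{P. psd P}"] ne convex_psd closed_psd
    by blast
  have b: "b < 0" using A2[OF psd_zero] by simp
  have A3: "0 \<le> inner A P" if "psd P" for P
  proof (rule ccontr)
    assume neg: "\<not> 0 \<le> inner A P"
    \<comment> \<open>Both \<open>b\<close> and \<open>inner A P\<close> are negative, so this is a
      positive multiple of \<open>P\<close>, scaled to make the functional exactly \<open>b\<close>,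
      against the strict bound \<open>A2\<close>.\<close>
    have "b < inner A ((b / inner A P) *\<^sub>R P)"
      using b neg by (intro A2 psd_scaleR that) (simp add: divide_nonpos_neg)
    then show False using neg by simp
  qed
  define \<rho>0 where "\<rho>0 = A + ctranspose A"
  have "hermitian \<rho>0"
    by (simp add: \<rho>0_def hermitian_def ctranspose_def vec_eq_iff add.commute)
  moreover have "0 \<le> Re (cdot x (\<rho>0 *v x))" for x
  proof -
    have "Re (cdot x (\<rho>0 *v x)) = 2 * inner A (outer x)"
      unfolding \<rho>0_def using psd_outer[of x]
      by (subst inner_hermitian[symmetric]) (auto simp: psd_iff trace_mult_outer)
    then show ?thesis using A3[OF psd_outer] by simp
  qed
  ultimately have psd: "psd \<rho>0" by (simp add: psd_iff)
  have neg: "Re (trace (\<rho>0 ** ?F \<sigma>)) < 0" if "\<sigma> \<in> ?D" for \<sigma>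
  proof -
    have "hermitian \<sigma>" using D that by (auto simp: density_matrix_def psd_iff)
    then show ?thesis
      using A1[OF that] b by (simp add: \<rho>0_def inner_hermitian hermitian_id_tensor[OF lin hp])
  qed
  define t where "t = Re (trace \<rho>0)"
  have "t > 0"
  proof -
    \<comment> \<open>The strict separation gives a nonzero pairing with \<open>\<rho>0\<close>,
      which rules out trace zero.\<close>
    obtain \<sigma> where "\<sigma> \<in> ?D" using ne by blast
    from neg[OF this] have "trace (?F \<sigma> ** \<rho>0) \<noteq> 0"
      by (subst trace_mul_sym) auto
    then show ?thesis unfolding t_def by (rule psd_trace(2)[OF psd])
  qed
  define \<rho> where "\<rho> = (1 / t) *\<^sub>R \<rho>0"
  have "trace \<rho>0 = of_real t"
    unfolding t_def by (rule psd_trace(1)[OF psd])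
  then have "density_matrix \<rho>"
    using \<open>t > 0\<close> psd by (simp add: \<rho>_def density_matrix_def psd_scaleR trace_scaleR)
  moreover have "Re (cdot x (id_tensor \<Psi> \<rho> *v x)) < 0" if "x \<in> S" "x \<noteq> 0" for x
  proof -
    \<comment> \<open>The separation speaks only of unit vectors of \<open>S\<close>, whose
      \<open>outer\<close> lies in \<open>?D\<close>; the general case follows since the form scales
      with \<open>(norm x)\<^sup>2\<close>.\<close>
    define e where "e = of_real (1 / norm x) *s x"
    have "linear (id_tensor \<Psi> :: complex^('m \<times> 'n)^('m \<times> 'n) \<Rightarrow> _)"
      using adj by (intro linear_mscale_imp_linear linear_id_tensor) (simp add: is_adjoint_map_def)
    then have Psi: "id_tensor \<Psi> \<rho> = (1 / t) *\<^sub>R id_tensor \<Psi> \<rho>0"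
      by (simp add: \<rho>_def linear_scale)
    have x: "x = of_real (norm x) *s e" using that by (simp add: e_def)
    have "Re (trace (\<rho>0 ** ?F (outer e))) < 0"
      using unit[OF that] by (intro neg hull_inc) (simp add: e_def)
    then have e: "Re (cdot e (id_tensor \<Psi> \<rho>0 *v e)) < 0"
      by (simp add: trace_id_tensor_adjoint[OF lin adj] trace_mult_outer)
    have "cdot x (id_tensor \<Psi> \<rho> *v x) =
        of_real ((norm x)\<^sup>2 / t) * cdot e (id_tensor \<Psi> \<rho>0 *v e)"
      by (subst (1 2) x)
        (simp add: Psi scaleR_matrix_vector_mult cdot_scale vec.scale power2_eq_square)
    then have "Re (cdot x (id_tensor \<Psi> \<rho> *v x)) =
        (norm x)\<^sup>2 / t * Re (cdot e (id_tensor \<Psi> \<rho>0 *v e))"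
      by (simp only: Re_complex_of_real Im_complex_of_real times_complex.sel)
    also have "\<dots> < 0"
      using e that \<open>t > 0\<close> by (intro mult_pos_neg) auto
    finally show ?thesis .
  qed
  ultimately show ?thesis
    using that[of \<rho>] sub by (simp add: negative_on_def)
qed

section \<open>The two inequalities between the eigenvalue count and the non-positive
  dimension\<close>

theorem theorem1:
  fixes \<Phi> :: "complex^'n^'n \<Rightarrow> complex^'n^'n"
  assumes "Vector_Spaces.linear mscale mscale \<Phi>"
    and "hermiticity_preserving \<Phi>"
  shows "(\<exists>\<rho> :: complex^('m::finite \<times> 'n)^('m \<times> 'n).
            density_matrix \<rho> \<and>
            num_neg_eigenvalues (id_tensor (adjoint_map \<Phi>) \<rho>) = non_positive_dim TYPE('m) \<Phi>) \<and>
         (\<forall>\<rho> :: complex^('m \<times> 'n)^('m \<times> 'n).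
            density_matrix \<rho> \<longrightarrow>
            num_neg_eigenvalues (id_tensor (adjoint_map \<Phi>) \<rho>) \<le> non_positive_dim TYPE('m) \<Phi>)"
proof -
  let ?\<Psi> = "adjoint_map \<Phi>"
  let ?dims = "{vec.dim S |S :: (complex^('m \<times> 'n)) set. non_positive_subspace \<Phi> S}"
  note adj = is_adjoint_map_adjoint_map[OF assms]
  have herm: "hermitian (id_tensor ?\<Psi> \<rho>)" if "density_matrix \<rho>"
    for \<rho> :: "complex^('m \<times> 'n)^('m \<times> 'n)"
    using that adj
    by (intro hermitian_id_tensor) (auto simp: is_adjoint_map_def density_matrix_def psd_iff)
  have upper: "num_neg_eigenvalues (id_tensor ?\<Psi> \<rho>) \<le> non_positive_dim TYPE('m) \<Phi>"
    if \<rho>: "density_matrix \<rho>" for \<rho> :: "complex^('m \<times> 'n)^('m \<times> 'n)"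
  proof -
    obtain S where S: "negative_on (id_tensor ?\<Psi> \<rho>) S"
      "vec.dim S = num_neg_eigenvalues (id_tensor ?\<Psi> \<rho>)"
      using exists_negative_on_num_neg[OF herm[OF \<rho>]] by blast
    \<comment> \<open>The pairing of \<open>\<rho>\<close> with
      \<open>id_tensor \<Phi> \<sigma>\<close> equals that of
      \<open>id_tensor ?\<Psi> \<rho>\<close> with \<open>\<sigma>\<close>, which is negative; two
      positive semidefinite matrices would pair to a nonnegative value.\<close>
    have "\<not> psd (id_tensor \<Phi> \<sigma>)" if "density_matrix \<sigma>" "supp \<sigma> \<subseteq> S" for \<sigma>
    proof
      assume "psd (id_tensor \<Phi> \<sigma>)"
      then have "0 \<le> Re (trace (\<rho> ** id_tensor \<Phi> \<sigma>))"
        using \<rho> by (intro trace_psd_mult_nonneg) (auto simp: density_matrix_def)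
      then show False
        using trace_negative_on_less_0[OF S(1) that]
        by (simp add: trace_id_tensor_adjoint[OF assms(1) adj])
    qed
    then have "non_positive_subspace \<Phi> S"
      using S(1) by (auto simp: non_positive_subspace_def negative_on_def)
    then have "vec.dim S \<in> ?dims" by blast
    then show ?thesis
      unfolding non_positive_dim_def S(2)[symmetric] by (rule Max_ge[OF finite_non_positive_dims])
  qed
  have "?dims \<noteq> {}" using non_positive_subspace_zero by blast
  then have "non_positive_dim TYPE('m) \<Phi> \<in> ?dims"
    unfolding non_positive_dim_def by (rule Max_in[OF finite_non_positive_dims])
  then obtain S :: "(complex^('m \<times> 'n)) set"
    where S: "non_positive_subspace \<Phi> S" "non_positive_dim TYPE('m) \<Phi> = vec.dim S"
    by blast
  \<comment> \<open>For \<open>S\<close> of maximal dimension, the witness has at least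
    \<open>vec.dim S\<close> negative eigenvalues, and \<open>upper\<close> turns this into
    equality.\<close>
  obtain \<rho> where \<rho>: "density_matrix \<rho>" "negative_on (id_tensor ?\<Psi> \<rho>) S"
    using non_positive_subspace_witness[OF assms adj S(1)] by blast
  then have "vec.dim S \<le> num_neg_eigenvalues (id_tensor ?\<Psi> \<rho>)"
    by (intro negative_on_dim_le herm)
  with upper[OF \<rho>(1)] S(2)
  have "num_neg_eigenvalues (id_tensor ?\<Psi> \<rho>) = non_positive_dim TYPE('m) \<Phi>"
    by linarith
  with \<rho>(1) upper show ?thesis by blast
qed

end
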